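(* Let $r,s,k$ be positive integers with $1\le s<r/2$, $\gcd(s,\,r-s,\,r+s,\,2r-s)=1$, and $$k\ \ge\ \frac{64r^{9}s}{(r-2s)^{3}}.$$ Then for all $n\ge 0$ the coefficient of $q^n$ in $$\frac{\sum_{j=0}^{\infty}(-1)^{j}q^{r(j^{2}+(2k+1)j)/2-sj}\left(1-q^{2js+(2k+1)s}\right)}{(1-q^{s})(1-q^{r-s})(1-q^{r+s})(1-q^{2r-s})}$$ is nonnegative; and thereby, for such $k$, the coefficient of $q^n$ in $$(-1)^{k}\,\frac{\sum_{j=k}^{\infty}(-1)^j q^{r j(j+1)/2}\left(q^{-sj}-q^{(j+1)s}\right)}{\left(q^s,q^{r-s};q^r\right)_{\infty}}$$ is nonnegative for all $n\ge 0$.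
   Context: Here $\gcd(s,r-s,r+s,2r-s)$ denotes the greatest common divisor of the four integers, and $|q|<1$. Notation: $(a;q)_\infty=\prod_{n\ge 0}(1-aq^n)$ and $(a_1,\dots,a_m;q)_\infty=(a_1;q)_\infty\cdots(a_m;q)_\infty$, so $(q^s,q^{r-s};q^r)_\infty=\prod_{n\ge 0}(1-q^{s+rn})(1-q^{r-s+rn})$. *)

theory Defs
  imports "HOL-Analysis.Analysis"
begin

text \<open>
  The \<open>q\<close>-series are formal power series in \<open>q\<close> = \<^const>\<open>fps_X\<close>, with \<^const>\<open>suminf\<close> and
  \<^const>\<open>prodinf\<close> taken in the metric topology of \<^typ>\<open>real fps\<close>, where convergence means that
  each coefficient is eventually constant.  Convergence of the series and products used
  is proved below, so no default value of these operators is involved.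
\<close>

definition qpoch_inf :: "real fps \<Rightarrow> real fps \<Rightarrow> real fps" where
  "qpoch_inf a q = (\<Prod>n. 1 - a * q ^ n)"

definition main_term :: "nat \<Rightarrow> nat \<Rightarrow> nat \<Rightarrow> nat \<Rightarrow> real fps" where
  "main_term r s k j =
     (- 1) ^ j * fps_X ^ (r * (j\<^sup>2 + (2 * k + 1) * j) div 2 - s * j)
       * (1 - fps_X ^ (2 * j * s + (2 * k + 1) * s))"

text \<open>
  In the next definition the product of \<open>q\<close> to the power \<open>rj(j+1)/2\<close> with the difference of
  \<open>q\<close> to the power \<open>-sj\<close> and \<open>q\<close> to the power \<open>(j+1)s\<close> is multiplied out, since the negative
  power alone is not a power series.  For \<open>2s < r\<close>, the divisions and subtractions of natural
  numbers in the exponents of both definitions are exact: see \<open>main_exponent\<close> and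
  \<open>tail_exponent\<close>.
\<close>

definition tail_term :: "nat \<Rightarrow> nat \<Rightarrow> nat \<Rightarrow> real fps" where
  "tail_term r s j =
     (- 1) ^ j * (fps_X ^ (r * j * (j + 1) div 2 - s * j)
                  - fps_X ^ (r * j * (j + 1) div 2 + (j + 1) * s))"

lemma tail_exponent:
  fixes r s j :: nat
  assumes "2 * s < r"
  shows "2 dvd r * j * (j + 1)" and "s * j + j \<le> r * j * (j + 1) div 2"
proof -
  show even: "2 dvd r * j * (j + 1)"
    by simp
  have "2 * (s * j + j) \<le> r * j * (j + 1)"
  proof (cases "j = 0")
    case False
    have "2 * (s * j + j) = (2 * s + 2) * j"
      by (simp add: algebra_simps)
    also have "\<dots> \<le> ((2 * s + 1) * (j + 1)) * j"
      using False by (intro mult_right_mono) (auto simp: algebra_simps)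
    also have "\<dots> \<le> (r * (j + 1)) * j"
      using assms by (intro mult_right_mono) auto
    finally show ?thesis
      by (simp add: mult_ac)
  qed auto
  then show "s * j + j \<le> r * j * (j + 1) div 2"
    by (metis div_le_mono nonzero_mult_div_cancel_left zero_neq_numeral)
qed

lemma main_exponent:
  fixes r s k j :: nat
  assumes "2 * s < r"
  shows "2 dvd r * (j\<^sup>2 + (2 * k + 1) * j)"
    and "s * j + j \<le> r * (j\<^sup>2 + (2 * k + 1) * j) div 2"
proof -
  show "2 dvd r * (j\<^sup>2 + (2 * k + 1) * j)"
    by simp
  have "r * j * (j + 1) \<le> r * (j\<^sup>2 + (2 * k + 1) * j)"
    by (simp add: algebra_simps power2_eq_square)
  then have "r * j * (j + 1) div 2 \<le> r * (j\<^sup>2 + (2 * k + 1) * j) div 2"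
    by (rule div_le_mono)
  with tail_exponent(2)[OF assms, of j]
  show "s * j + j \<le> r * (j\<^sup>2 + (2 * k + 1) * j) div 2"
    by linarith
qed

lemma summable_fps:
  fixes f :: "nat \<Rightarrow> real fps"
  assumes "\<And>j n. n < j \<Longrightarrow> fps_nth (f j) n = 0"
  shows "summable f"
proof -
  have "(\<lambda>m. \<Sum>j<m. f j) \<longlonglongrightarrow> Abs_fps (\<lambda>n. \<Sum>j\<le>n. fps_nth (f j) n)"
  proof (rule tendsto_fpsI)
    fix n
    show "\<forall>\<^sub>F m in sequentially. fps_nth (\<Sum>j<m. f j) n =
            fps_nth (Abs_fps (\<lambda>n. \<Sum>j\<le>n. fps_nth (f j) n)) n"
      using eventually_gt_at_top[of n]
      by eventually_elim
        (auto simp: fps_sum_nth assms not_le intro!: sum.mono_neutral_right intro: leI)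
  qed
  then show ?thesis
    unfolding summable_def sums_def by blast
qed

lemma summable_main_term:
  assumes "2 * s < r"
  shows "summable (main_term r s k)"
proof (rule summable_fps)
  fix j n :: nat
  assume "n < j"
  with main_exponent(2)[OF assms, of j k]
  have "n < r * (j\<^sup>2 + (2 * k + 1) * j) div 2 - s * j"
    by linarith
  then show "fps_nth (main_term r s k j) n = 0"
    unfolding main_term_def
    by (cases "even j") (simp_all add: mult.assoc fps_X_power_mult_nth)
qed

lemma summable_tail_term:
  assumes "2 * s < r"
  shows "summable (\<lambda>i. tail_term r s (i + k))"
proof (rule summable_fps)
  fix j n :: nat
  assume "n < j"
  with tail_exponent(2)[OF assms, of "j + k"]
  have "n < r * (j + k) * (j + k + 1) div 2 - s * (j + k)"
       "n < r * (j + k) * (j + k + 1) div 2 + (j + k + 1) * s"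
    by linarith+
  then show "fps_nth (tail_term r s (j + k)) n = 0"
    unfolding tail_term_def
    by (cases "even (j + k)") (simp_all add: fps_X_power_nth del: even_add)
qed

lemma has_prod_qpoch_inf:
  fixes a b :: nat
  assumes "a > 0" "b > 0"
  shows "(\<lambda>n. 1 - fps_X ^ a * (fps_X ^ b) ^ n) has_prod qpoch_inf (fps_X ^ a) (fps_X ^ b)"
proof -
  define f :: "nat \<Rightarrow> real fps" where "f = (\<lambda>n. 1 - fps_X ^ a * (fps_X ^ b) ^ n)"
  define P :: "nat \<Rightarrow> real fps" where
    "P = (\<lambda>m. \<Prod>i\<le>m. 1 - fps_X ^ a * (fps_X ^ b) ^ i)"
  have step: "fps_nth (P (Suc m)) n = fps_nth (P m) n" if "n \<le> m" for m n
  proof -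
    have "P (Suc m) = P m - fps_X ^ (a + b * Suc m) * P m"
      by (simp add: P_def algebra_simps power_add power_mult)
    moreover have "m < a + b * Suc m"
      using assms by (cases b) auto
    ultimately show ?thesis
      using that by (simp add: fps_X_power_mult_nth)
  qed
  have stable: "fps_nth (P m) n = fps_nth (P n) n" if "n \<le> m" for m n
    using that by (induction m rule: dec_induct) (auto simp: step)
  have lim: "P \<longlonglongrightarrow> Abs_fps (\<lambda>n. fps_nth (P n) n)"
  proof (rule tendsto_fpsI)
    fix n
    show "\<forall>\<^sub>F m in sequentially. fps_nth (P m) n = fps_nth (Abs_fps (\<lambda>n. fps_nth (P n) n)) n"
      using eventually_ge_at_top[of n] by eventually_elim (subst fps_nth_Abs_fps, rule stable)
  qed
  have "fps_nth (P 0) 0 = 1"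
    using assms by (simp add: P_def)
  have "Abs_fps (\<lambda>n. fps_nth (P n) n) \<noteq> 0"
  proof
    assume "Abs_fps (\<lambda>n. fps_nth (P n) n) = 0"
    from arg_cong[OF this, of "\<lambda>F. fps_nth F 0"] \<open>fps_nth (P 0) 0 = 1\<close> show False
      by simp
  qed
  with lim have raw: "raw_has_prod f 0 (Abs_fps (\<lambda>n. fps_nth (P n) n))"
    by (simp only: raw_has_prod_def P_def f_def add_0_right simp_thms)
  have nonzero: "f i \<noteq> 0" for i
  proof
    assume "f i = 0"
    from arg_cong[OF this, of "\<lambda>F. fps_nth F 0"] show False
      using assms by (simp add: f_def)
  qed
  have "f has_prod Abs_fps (\<lambda>n. fps_nth (P n) n)"
    using raw by (simp only: has_prod_def simp_thms)
  moreover have "p = Abs_fps (\<lambda>n. fps_nth (P n) n)" if "f has_prod p" for p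
    using that nonzero raw unfolding has_prod_def raw_has_prod_def
    by (blast intro: LIMSEQ_unique)
  ultimately have "f has_prod prodinf f"
    unfolding prodinf_def by (rule theI)
  then show ?thesis
    by (simp only: f_def qpoch_inf_def)
qed

end

theory Submission
  imports Defs "HOL-Number_Theory.Cong"
begin

text \<open>
  The factor \<open>1 - q^s\<close> divides each term of the numerator exactly, so the coefficient of \<open>q^n\<close> is
  \<open>\<Sum>j. (-1)^j f j\<close>, where \<open>f j\<close> is a sum of \<open>2j + 2k + 1\<close> values of the number of
  partitions into the parts \<open>b = r - s\<close>, \<open>c = r + s\<close>, \<open>d = 2r - s\<close>.  That number is \<open>m^2/(2bcd)\<close> up to
  an error \<open>1 + 2m/r\<close>, and the errors sum to \<open>O((n/r)^2)\<close>.  For the leading quadratic part,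
  \<open>2 \<Sum>j. (-1)^j f j = f 0 + \<Sum>i. (f (2i) - 2 f (2i+1) + f (2i+2))\<close>,
  where convexity of \<open>max(0,u)^2\<close> bounds the second differences from below by a total of
  \<open>-60 n^2\<close>, whereas \<open>f 0\<close> is at least \<open>(k + 1) n^2 / 4\<close> as soon as a second term contributes.
  Hence a value of \<open>k\<close> larger than a constant multiple of \<open>r\<close> suffices.

  The second quotient is a power of \<open>q\<close> times the first quotient times the reciprocal of the
  remaining factors of the infinite product, all with nonnegative coefficients.
\<close>

section \<open>Formal power series\<close>

definition nonneg_fps :: "real fps \<Rightarrow> bool" where
  "nonneg_fps f \<longleftrightarrow> (\<forall>n. 0 \<le> fps_nth f n)"

lemma nonneg_fps_X_power: "nonneg_fps (fps_X ^ a)"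
  by (simp add: nonneg_fps_def fps_X_power_nth)

lemma nonneg_fps_mult: "nonneg_fps f \<Longrightarrow> nonneg_fps g \<Longrightarrow> nonneg_fps (f * g)"
  by (simp add: nonneg_fps_def fps_mult_nth sum_nonneg)

lemma nonneg_fps_prod: "(\<And>i. i \<in> I \<Longrightarrow> nonneg_fps (f i)) \<Longrightarrow> nonneg_fps (prod f I)"
  by (induction I rule: infinite_finite_induct)
    (auto simp: nonneg_fps_mult, auto simp: nonneg_fps_def)

lemma inverse_one_minus_fps_X_power:
  fixes a :: nat
  assumes "a > 0"
  shows "inverse (1 - fps_X ^ a :: real fps) = Abs_fps (\<lambda>n. if a dvd n then 1 else 0)"
proof -
  have "(1 - fps_X ^ a) * Abs_fps (\<lambda>n. if a dvd n then 1 else 0) = (1 :: real fps)"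
    using assms
    by (intro fps_ext) (auto simp: left_diff_distrib fps_X_power_mult_nth dvd_minus_self)
  then show ?thesis
    by (rule fps_inverse_unique)
qed

lemma nonneg_fps_inverse_one_minus:
  "a > 0 \<Longrightarrow> nonneg_fps (inverse (1 - fps_X ^ a))"
  by (simp add: nonneg_fps_def inverse_one_minus_fps_X_power)

text \<open>\<open>1/f - 1/g = (g - f)/(f g)\<close>, and \<open>g - f\<close> vanishes through
  degree \<open>n\<close>.\<close>

lemma fps_inverse_nth_cong:
  fixes f g :: "'a :: field fps"
  assumes "\<And>i. i \<le> n \<Longrightarrow> fps_nth f i = fps_nth g i" and "fps_nth f 0 \<noteq> 0"
  shows "fps_nth (inverse f) n = fps_nth (inverse g) n"
proof -
  have "inverse f - inverse g = (g - f) * (inverse f * inverse g)"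
  proof -
    have "inverse f * f = 1" "inverse g * g = 1"
      using assms by (auto intro!: inverse_mult_eq_1)
    then have "inverse f - inverse g = inverse f * (inverse g * g) - (inverse f * f) * inverse g"
      by simp
    then show ?thesis
      by (simp add: algebra_simps)
  qed
  moreover have "fps_nth ((g - f) * (inverse f * inverse g)) n = 0"
    unfolding fps_mult_nth by (intro sum.neutral) (auto simp: assms)
  ultimately have "fps_nth (inverse f - inverse g) n = 0"
    by simp
  then show ?thesis
    by simp
qed

text \<open>Terms with index above \<open>n\<close> do not reach degree \<open>n\<close>, so the
  eventually constant coefficient of the partial sums is already attained at any cutoff
  \<open>N > n\<close>. The cutoff stays free so that an even one can be chosen later.\<close>

lemma fps_nth_suminf_mult:
  fixes f :: "nat \<Rightarrow> real fps"
  assumes "\<And>j n. n < j \<Longrightarrow> fps_nth (f j) n = 0" and "n < N"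
  shows "fps_nth (suminf f * g) n = (\<Sum>j<N. fps_nth (f j * g) n)"
proof -
  have "(\<lambda>m. \<Sum>j<m. f j) \<longlonglongrightarrow> suminf f"
    using summable_fps[OF assms(1)] by (rule summable_LIMSEQ)
  then have ev: "\<forall>\<^sub>F m in sequentially. fps_nth (\<Sum>j<m. f j) i = fps_nth (suminf f) i" for i
    by (simp add: tendsto_fps_iff)
  have nth: "fps_nth (suminf f) i = (\<Sum>j<N. fps_nth (f j) i)" if "i < N" for i
  proof -
    obtain m where m: "m \<ge> N" "fps_nth (\<Sum>j<m. f j) i = fps_nth (suminf f) i"
      using eventually_happens'[OF _ eventually_conj[OF ev[of i] eventually_ge_at_top[of N]]]
      by auto
    have "(\<Sum>j<m. fps_nth (f j) i) = (\<Sum>j<N. fps_nth (f j) i)"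
      using m(1) that by (intro sum.mono_neutral_right) (auto intro!: assms(1))
    with m show ?thesis
      by (simp add: fps_sum_nth)
  qed
  have "fps_nth (suminf f * g) n = (\<Sum>i=0..n. \<Sum>j<N. fps_nth (f j) i * fps_nth g (n - i))"
    unfolding fps_mult_nth sum_distrib_right[symmetric]
    using assms(2) by (intro sum.cong) (auto simp: nth)
  also have "\<dots> = (\<Sum>j<N. fps_nth (f j * g) n)"
    unfolding fps_mult_nth by (rule sum.swap)
  finally show ?thesis .
qed

section \<open>Coefficients of infinite q-products and of their reciprocals\<close>

lemma qpoch_inf_nth_eventually:
  fixes a b :: nat
  assumes "a > 0" "b > 0"
  shows "\<forall>\<^sub>F m in sequentially.
    fps_nth (\<Prod>i<m. 1 - fps_X ^ (a + b * i)) n = fps_nth (qpoch_inf (fps_X ^ a) (fps_X ^ b)) n"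
  using has_prod_imp_tendsto'[OF has_prod_qpoch_inf[OF assms]]
  unfolding tendsto_fps_iff power_mult[symmetric] power_add[symmetric] by blast

lemma qpoch_inf_nth_0:
  fixes a b :: nat
  assumes "a > 0" "b > 0"
  shows "fps_nth (qpoch_inf (fps_X ^ a) (fps_X ^ b)) 0 = 1"
proof -
  have "fps_nth (\<Prod>i<m. 1 - fps_X ^ (a + b * i) :: real fps) 0 = 1" for m
    using assms by (induction m) (auto simp: fps_X_power_nth)
  then show ?thesis
    using qpoch_inf_nth_eventually[OF assms, of 0] by simp
qed

lemma qpoch_inf_step:
  fixes a b :: nat
  assumes "a > 0" "b > 0"
  shows "qpoch_inf (fps_X ^ a) (fps_X ^ b)
           = (1 - fps_X ^ a) * qpoch_inf (fps_X ^ (a + b)) (fps_X ^ b)"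
proof (rule fps_ext)
  fix n
  have "\<forall>\<^sub>F m in sequentially.
      fps_nth (\<Prod>i<Suc m. 1 - fps_X ^ (a + b * i)) n
        = fps_nth (qpoch_inf (fps_X ^ a) (fps_X ^ b)) n"
    using qpoch_inf_nth_eventually[OF assms, of n] by (subst eventually_sequentially_Suc)
  moreover have ev: "\<forall>\<^sub>F m in sequentially.
      fps_nth (\<Prod>i<m. 1 - fps_X ^ (a + b + b * i)) l
        = fps_nth (qpoch_inf (fps_X ^ (a + b)) (fps_X ^ b)) l" for l
    using assms by (intro qpoch_inf_nth_eventually) auto
  \<comment> \<open>Multiplication by \<open>1 - fps_X ^ a\<close> brings only the coefficients
    \<open>n\<close> and \<open>n - a\<close> of the shifted product into play.\<close>
  note ev[of n] ev[of "n - a"]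
  ultimately have "\<forall>\<^sub>F m in sequentially. fps_nth (qpoch_inf (fps_X ^ a) (fps_X ^ b)) n
        = fps_nth ((1 - fps_X ^ a) * qpoch_inf (fps_X ^ (a + b)) (fps_X ^ b)) n"
  proof eventually_elim
    case (elim m)
    have "(\<Prod>i<Suc m. 1 - fps_X ^ (a + b * i))
        = (1 - fps_X ^ a) * (\<Prod>i<m. 1 - fps_X ^ (a + b + b * i) :: real fps)"
      by (subst prod.lessThan_Suc_shift) (simp add: add_ac)
    with elim show ?case
      by (auto simp: left_diff_distrib fps_X_power_mult_nth simp del: prod.lessThan_Suc)
  qed
  then show "fps_nth (qpoch_inf (fps_X ^ a) (fps_X ^ b)) n
      = fps_nth ((1 - fps_X ^ a) * qpoch_inf (fps_X ^ (a + b)) (fps_X ^ b)) n"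
    by simp
qed

text \<open>Through degree \<open>n\<close> the infinite product agrees with a finite one, whose
  reciprocal is a product of geometric series.\<close>

lemma nonneg_fps_inverse_qpoch_inf:
  fixes a b :: nat
  assumes "a > 0" "b > 0"
  shows "nonneg_fps (inverse (qpoch_inf (fps_X ^ a) (fps_X ^ b)))"
  unfolding nonneg_fps_def
proof
  fix n
  let ?P = "\<lambda>m. \<Prod>i<m. 1 - fps_X ^ (a + b * i) :: real fps"
  have "\<forall>\<^sub>F m in sequentially. \<forall>i\<in>{..n}.
      fps_nth (?P m) i = fps_nth (qpoch_inf (fps_X ^ a) (fps_X ^ b)) i"
    using qpoch_inf_nth_eventually[OF assms] by (intro eventually_ball_finite) auto
  then obtain m where m: "\<forall>i\<in>{..n}.
      fps_nth (?P m) i = fps_nth (qpoch_inf (fps_X ^ a) (fps_X ^ b)) i"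
    using eventually_happens' sequentially_bot by blast
  then have "fps_nth (?P m) 0 \<noteq> 0"
    using qpoch_inf_nth_0[OF assms] by simp
  with m have "fps_nth (inverse (qpoch_inf (fps_X ^ a) (fps_X ^ b))) n = fps_nth (inverse (?P m)) n"
    by (intro fps_inverse_nth_cong[symmetric]) auto
  moreover have "nonneg_fps (inverse (?P m))"
    unfolding inverse_prod_fps
    using assms by (intro nonneg_fps_prod nonneg_fps_inverse_one_minus) auto
  ultimately show "0 \<le> fps_nth (inverse (qpoch_inf (fps_X ^ a) (fps_X ^ b))) n"
    by (simp add: nonneg_fps_def)
qed

section \<open>Partitions into two and three part sizes\<close>

lemma card_residue_class:
  fixes M a m :: nat
  assumes "a < M"
  shows "\<bar>real (card {i. i \<le> m \<and> i mod M = a}) - real m / real M\<bar> \<le> 1"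
proof (cases "a \<le> m")
  case False
  then have empty: "{i. i \<le> m \<and> i mod M = a} = {}"
    using order_trans[OF mod_less_eq_dividend] by blast
  from False assms show ?thesis
    unfolding empty by simp
next
  case True
  have "bij_betw (\<lambda>t. a + M * t) {..(m - a) div M} {i. i \<le> m \<and> i mod M = a}"
  proof (rule bij_betwI[where g = "\<lambda>i. i div M"])
    have "a + M * t \<le> m" if "t \<le> (m - a) div M" for t
      using that True assms by (simp add: less_eq_div_iff_mult_less_eq mult.commute)
    then show "(\<lambda>t. a + M * t) \<in> {..(m - a) div M} \<rightarrow> {i. i \<le> m \<and> i mod M = a}"
      using assms by auto
    have "i div M \<le> (m - i mod M) div M" if "i \<le> m" for i
    proof -
      have "i div M = (i - i mod M) div M"
        using assms by (simp add: minus_mod_eq_mult_div)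
      also have "\<dots> \<le> (m - i mod M) div M"
        using that by (intro div_le_mono diff_le_mono)
      finally show ?thesis .
    qed
    then show "(\<lambda>i. i div M) \<in> {i. i \<le> m \<and> i mod M = a} \<rightarrow> {..(m - a) div M}"
      by auto
  qed (use assms in auto)
  then have card: "card {i. i \<le> m \<and> i mod M = a} = Suc ((m - a) div M)"
    using bij_betw_same_card by fastforce
  define q where "q = (m - a) div M"
  have "M * q + a \<le> m"
    using True times_div_less_eq_dividend[of M "m - a"] unfolding q_def by linarith
  moreover have "m - a < M * Suc q"
    using assms dividend_less_times_div[of M "m - a"] by (simp add: q_def)
  ultimately have "real (M * q + a) \<le> real m" "real m \<le> real (a + M * Suc q)"
    unfolding of_nat_le_iff by linarith+
  moreover have "real a \<le> real M"
    using assms by simp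
  ultimately have "real M * real q \<le> real m" "real m \<le> real M * (real q + 2)"
    by (simp_all add: algebra_simps)
  then show ?thesis
    unfolding card q_def[symmetric] using assms
    by (auto simp: abs_le_iff field_simps)
qed

text \<open>A partition of \<open>m\<close> into parts \<open>b\<close> and \<open>d\<close> is
  determined by the total \<open>i\<close> of its parts \<open>b\<close>. By the Chinese remainder
  theorem the admissible \<open>i\<close> form one residue class modulo
  \<open>b * d\<close>.\<close>

lemma two_parts_asymptotics:
  fixes b d m :: nat
  assumes "coprime b d" "b > 0" "d > 0"
  shows "\<bar>fps_nth (inverse (1 - fps_X ^ b) * inverse (1 - fps_X ^ d) :: real fps) m
           - real m / (real b * real d)\<bar> \<le> 1"
proof -
  obtain a where a: "a < b * d" "[a = 0] (mod b)" "[a = m] (mod d)"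
    using binary_chinese_remainder_unique_nat[OF assms(1), of 0 m] assms by auto
  have residue: "b dvd i \<and> d dvd m - i \<longleftrightarrow> i mod (b * d) = a" if "i \<le> m" for i
  proof -
    have "b dvd i \<and> d dvd m - i \<longleftrightarrow> [i = 0] (mod b) \<and> [i = m] (mod d)"
      using that by (simp add: cong_0_iff cong_sym_eq[of i m] cong_altdef_nat)
    also have "\<dots> \<longleftrightarrow> [i = a] (mod b) \<and> [i = a] (mod d)"
      using a by (simp add: cong_def)
    also have "\<dots> \<longleftrightarrow> [i = a] (mod b * d)"
      using assms(1)
      by (auto intro: coprime_cong_mult_nat cong_dvd_modulus_nat[OF _ dvd_triv_left]
          cong_dvd_modulus_nat[OF _ dvd_triv_right])
    finally show ?thesis
      using a(1) by (simp add: cong_def)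
  qed
  have "fps_nth (inverse (1 - fps_X ^ b) * inverse (1 - fps_X ^ d) :: real fps) m
      = (\<Sum>i=0..m. if b dvd i \<and> d dvd m - i then 1 else 0)"
    using assms by (simp add: fps_mult_nth inverse_one_minus_fps_X_power if_distrib cong: if_cong)
      (intro sum.cong, auto)
  also have "\<dots> = real (card {i. i \<le> m \<and> i mod (b * d) = a})"
    by (simp add: residue sum.If_cases Int_def cong: conj_cong)
  finally show ?thesis
    using card_residue_class[OF a(1), of m] by simp
qed

text \<open>Summing the two-part estimate over the number \<open>z\<close> of parts \<open>c\<close>
  costs at most 1 for each of the \<open>Z + 1\<close> values of \<open>z\<close>. The sum of the
  main terms is an arithmetic progression close to \<open>m^2/(2c)\<close>, divided by
  \<open>b * d\<close>.\<close>

lemma three_parts_asymptotics: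
  fixes b c d m :: nat
  assumes "coprime b d" "b > 0" "c > 0" "d > 0"
  shows "\<bar>fps_nth (inverse (1 - fps_X ^ b) * inverse (1 - fps_X ^ d) * inverse (1 - fps_X ^ c) :: real fps) m
           - (real m)\<^sup>2 / (2 * real b * real c * real d)\<bar>
         \<le> real m / (real b * real d) + real m / real c + 1"
proof -
  define G :: "real fps" where "G = inverse (1 - fps_X ^ b) * inverse (1 - fps_X ^ d)"
  define Z where "Z = m div c"
  define D where "D = real b * real d"
  have D: "D > 0"
    using assms by (simp add: D_def)
  have Z: "c * Z \<le> m" "m < c * Suc Z"
    using assms unfolding Z_def by (auto intro: dividend_less_times_div)
  have "fps_nth (G * inverse (1 - fps_X ^ c)) m = (\<Sum>i\<in>{..m}. if c dvd i then fps_nth G (m - i) else 0)"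
    using assms unfolding mult.commute[of G]
    by (simp add: fps_mult_nth inverse_one_minus_fps_X_power if_distrib atLeast0AtMost cong: if_cong)
       (intro sum.cong, auto)
  also have "\<dots> = (\<Sum>i\<in>{i. i \<le> m \<and> c dvd i}. fps_nth G (m - i))"
    by (simp add: sum.If_cases Int_def)
  also have "\<dots> = (\<Sum>z\<le>Z. fps_nth G (m - c * z))"
  proof (rule sum.reindex_bij_witness[where i = "\<lambda>z. c * z" and j = "\<lambda>i. i div c"])
    fix z assume "z \<in> {..Z}"
    then have "c * z \<le> c * Z" by simp
    with Z(1) have "c * z \<le> m" by linarith
    then show "c * z \<in> {i. i \<le> m \<and> c dvd i}" by simp
  qed (use assms in \<open>auto simp: Z_def div_le_mono\<close>)
  finally have sum: "fps_nth (G * inverse (1 - fps_X ^ c)) m = (\<Sum>z\<le>Z. fps_nth G (m - c * z))" .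
  have "\<bar>(\<Sum>z\<le>Z. fps_nth G (m - c * z)) - (\<Sum>z\<le>Z. real (m - c * z) / D)\<bar>
      \<le> (\<Sum>z\<le>Z. \<bar>fps_nth G (m - c * z) - real (m - c * z) / D\<bar>)"
    unfolding sum_subtractf[symmetric] by (rule sum_abs)
  also have "\<dots> \<le> (\<Sum>z\<le>Z. 1)"
    unfolding G_def D_def using two_parts_asymptotics assms by (intro sum_mono) auto
  finally have err1: "\<bar>(\<Sum>z\<le>Z. fps_nth G (m - c * z)) - (\<Sum>z\<le>Z. real (m - c * z)) / D\<bar> \<le> real Z + 1"
    by (simp add: sum_divide_distrib)
  have "(\<Sum>z\<le>Z. real (m - c * z)) = (\<Sum>z\<le>Z. real m - real c * real z)"
  proof (intro sum.cong refl)
    fix z assume "z \<in> {..Z}"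
    then have "c * z \<le> c * Z" by simp
    with Z(1) have "c * z \<le> m" by linarith
    then show "real (m - c * z) = real m - real c * real z"
      by (simp add: of_nat_diff)
  qed
  also have "\<dots> = (real Z + 1) * (real m - real c * real Z / 2)"
    by (induction Z) (simp_all add: field_simps)
  finally have tri: "(\<Sum>z\<le>Z. real (m - c * z)) = (real Z + 1) * (real m - real c * real Z / 2)" .
  define t where "t = real m - real c * real Z"
  have "real (c * Z) \<le> real m" "real m < real (c * Suc Z)"
    using Z by (simp_all only: of_nat_le_iff of_nat_less_iff)
  then have t: "0 \<le> t" "t < real c"
    by (simp_all add: t_def algebra_simps)
  have c: "real c > 0"
    using assms by simp
  \<comment> \<open>Here \<open>t\<close> is the remainder of \<open>m\<close> modulo
    \<open>c\<close>. As \<open>0 \<le> t < c\<close>, the right-hand side lies between 0 and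
    \<open>m\<close>.\<close>
  have "(real Z + 1) * (real m - real c * real Z / 2) - (real m)\<^sup>2 / (2 * real c)
      = real c * real Z / 2 + t - t\<^sup>2 / (2 * real c)"
    unfolding t_def using c by (simp add: field_simps power2_eq_square)
  moreover have "t\<^sup>2 / (2 * real c) \<le> t" 
    using t c by (simp add: field_simps power2_eq_square) (smt (verit) mult_left_mono)
  moreover have "t\<^sup>2 / (2 * real c) \<ge> 0"
    using c by simp
  moreover have "real c * real Z / 2 \<ge> 0" "real c * real Z / 2 + t \<le> real m"
    using c t by (auto simp: t_def)
  ultimately have "\<bar>(\<Sum>z\<le>Z. real (m - c * z)) - (real m)\<^sup>2 / (2 * real c)\<bar> \<le> real m"
    unfolding tri by linarith
  then have "\<bar>(\<Sum>z\<le>Z. real (m - c * z)) - (real m)\<^sup>2 / (2 * real c)\<bar> / D \<le> real m / D"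
    using D by (intro divide_right_mono) auto
  then have err2: "\<bar>(\<Sum>z\<le>Z. real (m - c * z)) / D - (real m)\<^sup>2 / (2 * real c) / D\<bar> \<le> real m / D"
    using D by (simp only: diff_divide_distrib[symmetric] abs_divide abs_of_pos)
  have "real Z \<le> real m / real c"
    using t c by (simp add: t_def field_simps)
  with err1 err2 have "\<bar>(\<Sum>z\<le>Z. fps_nth G (m - c * z)) - (real m)\<^sup>2 / (2 * real c) / D\<bar>
      \<le> real m / D + real m / real c + 1"
    by linarith
  then show ?thesis
    unfolding G_def[symmetric] sum D_def by (simp add: mult_ac)
qed

section \<open>Alternating sums with almost convex terms\<close>

text \<open>Each interior even-indexed value occurs in two consecutive second differences; the
  boundary terms supply the second copy of \<open>f 0\<close> and remove the surplus
  \<open>f (2 * L)\<close>.\<close>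

lemma alternating_sum_second_differences:
  fixes f :: "nat \<Rightarrow> real"
  shows "2 * (\<Sum>j<2 * L. (- 1) ^ j * f j)
           = f 0 - f (2 * L) + (\<Sum>i<L. f (2 * i) - 2 * f (2 * i + 1) + f (2 * i + 2))"
  by (induction L) (simp_all add: algebra_simps)

lemma sum_odd_le:
  fixes g :: "nat \<Rightarrow> real"
  assumes "\<And>j. 0 \<le> g j"
  shows "(\<Sum>i<L. g (2 * i + 1)) \<le> (\<Sum>j<2 * L. g j)"
proof (induction L)
  case (Suc L)
  with assms[of "2 * L"] show ?case by simp
qed simp

text \<open>The quadratic leading term of the counting function, extended by zero to negative
  arguments; the extension is still convex.\<close>

definition pos_sq :: "real \<Rightarrow> real" where
  "pos_sq u = (max 0 u)\<^sup>2"

lemma pos_sq_nonneg: "0 \<le> pos_sq u"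
  by (simp add: pos_sq_def)

lemma pos_sq_eq_0: "u \<le> 0 \<Longrightarrow> pos_sq u = 0"
  by (simp add: pos_sq_def)

text \<open>The derivative of \<open>pos_sq\<close> is nondecreasing, so to the left of
  \<open>u\<close> it is at most \<open>2 * max 0 u\<close>.\<close>

lemma pos_sq_decrease:
  assumes "0 \<le> \<delta>"
  shows "pos_sq u - pos_sq (u - \<delta>) \<le> 2 * \<delta> * max 0 u"
proof -
  consider "u \<le> 0" | "0 < u" "u \<le> \<delta>" | "\<delta> < u" "0 < u"
    by linarith
  then show ?thesis
  proof cases
    case 2
    then have "u * u \<le> 2 * \<delta> * u"
      by (intro mult_right_mono) auto
    with 2 show ?thesis
      by (simp add: pos_sq_def power2_eq_square)
  next
    case 3
    have "u\<^sup>2 - (u - \<delta>)\<^sup>2 = 2 * \<delta> * u - \<delta>\<^sup>2"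
      by (simp add: power2_eq_square algebra_simps)
    with 3 show ?thesis
      by (simp add: pos_sq_def)
  qed (use assms in \<open>simp add: pos_sq_def\<close>)
qed

text \<open>For \<delta> = 0 this is convexity; moving the left point further by \<delta> costs at
  most \<delta> times the slope at \<open>u\<close>. It is applied with \<delta> = \<open>r\<close>,
  the growth of the gaps between consecutive values of \<open>lag\<close>.\<close>

lemma pos_sq_second_difference:
  assumes "0 \<le> a" "0 \<le> \<delta>"
  shows "- (2 * \<delta> * max 0 u) \<le> pos_sq (u + a) - 2 * pos_sq u + pos_sq (u - a - \<delta>)"
proof -
  consider "u \<le> 0" | "0 < u" "u \<le> a + \<delta>" | "0 < u" "a + \<delta> < u"
    by linarith
  then show ?thesis
  proof cases
    case 1
    then show ?thesis
      by (simp add: pos_sq_nonneg pos_sq_eq_0)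
  next
    case 2
    then have "u * u \<le> (a + \<delta>) * u"
      by (intro mult_right_mono) auto
    then have "u * u \<le> a * u + \<delta> * u"
      by (simp add: distrib_right)
    moreover have "0 \<le> a * u" "0 \<le> \<delta> * u" "0 \<le> a * a"
      using 2 assms by simp_all
    moreover have "(u + a)\<^sup>2 - 2 * u\<^sup>2 = 2 * (a * u) + a * a - u * u"
      by (simp add: power2_eq_square algebra_simps)
    ultimately have "- (2 * \<delta> * u) \<le> (u + a)\<^sup>2 - 2 * u\<^sup>2"
      by linarith
    with 2 assms show ?thesis
      by (simp add: pos_sq_def)
  next
    case 3
    have "(u + a)\<^sup>2 - 2 * u\<^sup>2 + (u - a - \<delta>)\<^sup>2 = 2 * a\<^sup>2 + 2 * (a * \<delta>) + \<delta>\<^sup>2 - 2 * \<delta> * u"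
      by (simp add: power2_eq_square algebra_simps)
    moreover have "0 \<le> a * \<delta>"
      using assms by simp
    ultimately show ?thesis
      using 3 assms by (simp add: pos_sq_def)
  qed
qed

section \<open>Exponents and lengths of the numerator terms\<close>

locale truncated_theta =
  fixes r s k :: nat
  assumes s_pos: "0 < s" and k_pos: "0 < k" and less: "2 * s < r"
begin

text \<open>
  The \<open>j\<close>-th term of the numerator is \<open>(-1)^j q^(lag j) (1 - q^(s len j))\<close>.
\<close>

definition lag :: "nat \<Rightarrow> nat" where
  "lag j = r * (j\<^sup>2 + (2 * k + 1) * j) div 2 - s * j"

definition len :: "nat \<Rightarrow> nat" where
  "len j = 2 * j + 2 * k + 1"

lemma real_lag:
  "real (lag j) = real r * ((real j)\<^sup>2 + (2 * real k + 1) * real j) / 2 - real s * real j"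
proof -
  have "s * j \<le> r * (j\<^sup>2 + (2 * k + 1) * j) div 2"
    using main_exponent(2)[OF less, of j k] by linarith
  moreover have "real (r * (j\<^sup>2 + (2 * k + 1) * j) div 2)
      = real r * ((real j)\<^sup>2 + (2 * real k + 1) * real j) / 2"
    using real_of_nat_div[OF main_exponent(1)[OF less, of j k]] by (simp add: algebra_simps)
  ultimately show ?thesis
    unfolding lag_def by (simp only: of_nat_diff of_nat_mult)
qed

lemma lag_0: "lag 0 = 0"
  by (simp add: lag_def)

lemma le_lag: "j \<le> lag j"
  using main_exponent(2)[OF less, of j k] by (simp add: lag_def)

lemma real_lag_Suc:
  "real (lag (Suc j)) = real (lag j) + (real r * (real j + real k + 1) - real s)"
  unfolding real_lag by (simp add: field_simps power2_eq_square)

lemma lag_step_nonneg: "real s \<le> real r * (real j + real k + 1)"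
proof -
  have "real s \<le> real r * 1"
    using less by simp
  also have "\<dots> \<le> real r * (real j + real k + 1)"
    by (intro mult_left_mono) auto
  finally show ?thesis .
qed

lemma lag_le_Suc: "lag j \<le> lag (Suc j)"
  using real_lag_Suc[of j] lag_step_nonneg[of j] by (simp flip: of_nat_le_iff)

lemma lag_1_le: "1 \<le> j \<Longrightarrow> lag 1 \<le> lag j"
  using lift_Suc_mono_le[of lag 1 j] lag_le_Suc by simp

text \<open>\<open>lag 1\<close> is \<open>r(k + 1) - s\<close> and \<open>s < r/2\<close>. Thus a
  second row can contribute only when \<open>n\<close> is at least about \<open>r k\<close>.\<close>

lemma lag_1_ge: "real r * (2 * real k + 1) / 2 \<le> real (lag 1)"
  using less unfolding real_lag by (simp add: field_simps)

text \<open>With \<open>t\<close> the last active row, the lengths sum to at most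
  \<open>(t + 1)(t + 2k + 1)\<close>, whose dominant part \<open>t^2 + 2kt\<close> is at most
  \<open>2 lag t / r\<close>. The remainders \<open>2t\<close> and \<open>2k + 1\<close> are each at
  most \<open>2n/r\<close> as well, by \<open>k \<ge> 1\<close> and by
  \<open>lag 1 \<le> n\<close>.\<close>

lemma sum_len_le:
  assumes "lag 1 \<le> n"
  shows "(\<Sum>j<N. if lag j \<le> n then real (len j) else 0) \<le> 6 * real n / real r"
proof -
  have r: "real r > 0"
    using less by simp
  have fin: "finite {j. lag j \<le> n}"
    by (rule finite_subset[of _ "{..n}"]) (auto intro: order_trans[OF le_lag])
  define t where "t = Max {j. lag j \<le> n}"
  have t: "lag t \<le> n"
  proof -
    have "0 \<in> {j. lag j \<le> n}"
      by (simp add: lag_0)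
    then show ?thesis
      using Max_in[OF fin] unfolding t_def by blast
  qed
  have "(\<Sum>j<N. if lag j \<le> n then real (len j) else 0) = (\<Sum>j\<in>{..<N} \<inter> {j. lag j \<le> n}. real (len j))"
    by (simp add: sum.If_cases)
  also have "\<dots> \<le> (\<Sum>j\<le>t. real (len j))"
    using fin by (intro sum_mono2) (auto simp: t_def)
  also have "\<dots> = (real t + 1) * (real t + 2 * real k + 1)"
    by (induction t) (simp_all add: len_def algebra_simps)
  also have "\<dots> = ((real t)\<^sup>2 + 2 * real k * real t) + 2 * real t + (2 * real k + 1)"
    by (simp add: power2_eq_square algebra_simps)
  also have "\<dots> \<le> 2 * real n / real r + 2 * real n / real r + 2 * real n / real r"
  proof -
    have "2 * real s * real t \<le> real r * real t"
      using less by (intro mult_right_mono) linarith+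
    then have "real r * ((real t)\<^sup>2 + 2 * real k * real t) \<le> 2 * real (lag t)"
      unfolding real_lag by (simp add: algebra_simps)
    with t have "real r * ((real t)\<^sup>2 + 2 * real k * real t) \<le> 2 * real n"
      by linarith
    then have 1: "(real t)\<^sup>2 + 2 * real k * real t \<le> 2 * real n / real r"
      using r by (simp add: field_simps)
    have "1 * real t \<le> real k * real t"
      using k_pos by (intro mult_right_mono) auto
    then have 2: "2 * real t \<le> (real t)\<^sup>2 + 2 * real k * real t"
      by (simp add: add_increasing)
    have "real r * (2 * real k + 1) \<le> 2 * real n"
      using lag_1_ge assms by linarith
    then have "2 * real k + 1 \<le> 2 * real n / real r"
      using r by (simp add: field_simps)
    with 1 2 show ?thesis
      by linarith
  qed
  finally show ?thesis
    by simp
qed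

section \<open>The alternating sum for the leading quadratic part\<close>

definition model :: "nat \<Rightarrow> nat \<Rightarrow> real" where
  "model n j = (\<Sum>i<len j. pos_sq (real n - real (lag j) - real i * real s))"

lemma model_eq_0:
  assumes "n < lag j"
  shows "model n j = 0"
proof -
  have "real n - real (lag j) - real i * real s \<le> 0" for i
  proof -
    have "0 \<le> real i * real s"
      by simp
    with assms show ?thesis
      by linarith
  qed
  then show ?thesis
    by (simp add: model_def pos_sq_eq_0)
qed

text \<open>
  The rows \<open>j\<close>, \<open>j + 1\<close>, \<open>j + 2\<close> share the indices \<open>i < len j\<close>, where convexity applies.  The two
  further entries of row \<open>j + 1\<close>, counted twice with a minus sign, are matched with the four
  further entries of row \<open>j + 2\<close>, which leaves first differences of \<^const>\<open>pos_sq\<close> only.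
\<close>

lemma model_second_difference:
  "- (if lag (j + 1) \<le> n then 10 * real r * real n * real (len j) else 0)
     \<le> model n j - 2 * model n (j + 1) + model n (j + 2)"
proof -
  \<comment> \<open>\<open>u\<close> lists the arguments of the middle row. Those of row
    \<open>j\<close> are \<open>u i + a\<close>, and those of row \<open>j + 2\<close> are
    \<open>u i - a - r\<close>, because the gap grows by \<open>r\<close>.\<close>
  define u where "u = (\<lambda>i. real n - real (lag (j + 1)) - real i * real s)"
  define a where "a = real r * (real j + real k + 1) - real s"
  \<comment> \<open>A bound for all positive parts in the middle row that vanishes once this row
    starts beyond \<open>n\<close>.\<close>
  define w where "w = (if lag (j + 1) \<le> n then real n else 0)"
  define x where "x = len j"
  have a: "0 \<le> a"
    using lag_step_nonneg[of j] by (simp add: a_def)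
  have w: "max 0 (u i) \<le> w" for i
  proof -
    have "u i \<le> real n - real (lag (j + 1))"
      by (simp add: u_def)
    then show ?thesis
      by (simp add: w_def)
  qed
  have w0: "0 \<le> w"
    by (simp add: w_def)
  have m0: "model n j = (\<Sum>i<x. pos_sq (u i + a))"
    unfolding model_def x_def u_def a_def
    using real_lag_Suc[of j] by (intro sum.cong refl arg_cong[of _ _ pos_sq]) simp
  have m1: "model n (j + 1) = (\<Sum>i<x. pos_sq (u i)) + pos_sq (u x) + pos_sq (u (x + 1))"
  proof -
    have "len (j + 1) = Suc (Suc x)"
      by (simp add: len_def x_def)
    then show ?thesis
      by (simp add: model_def u_def)
  qed
  have m2: "model n (j + 2) = (\<Sum>i<x. pos_sq (u i - a - real r))
     + pos_sq (u x - (a + real r)) + pos_sq (u (x + 1) - (a + real r))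
     + pos_sq (u x - (a + real r + 2 * real s)) + pos_sq (u (x + 1) - (a + real r + 2 * real s))"
  proof -
    have "len (j + 2) = Suc (Suc (Suc (Suc x)))"
      by (simp add: len_def x_def)
    moreover have "real n - real (lag (j + 2)) - real i * real s = u i - a - real r" for i
      using real_lag_Suc[of "j + 1"] by (simp add: u_def a_def algebra_simps)
    ultimately have "model n (j + 2) = (\<Sum>i<Suc (Suc (Suc (Suc x))). pos_sq (u i - a - real r))"
      by (simp add: model_def)
    moreover have "u (Suc (Suc i)) - a - real r = u i - (a + real r + 2 * real s)" for i
      by (simp add: u_def algebra_simps)
    ultimately show ?thesis
      by (simp add: diff_diff_eq add_ac)
  qed
  have "- (2 * real r * w) \<le> pos_sq (u i + a) - 2 * pos_sq (u i) + pos_sq (u i - a - real r)" for i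
  proof -
    have "2 * real r * max 0 (u i) \<le> 2 * real r * w"
      using w by (intro mult_left_mono) auto
    with pos_sq_second_difference[OF a, of "real r" "u i"] show ?thesis
      by simp
  qed
  then have "(\<Sum>i<x. - (2 * real r * w))
      \<le> (\<Sum>i<x. pos_sq (u i + a) - 2 * pos_sq (u i) + pos_sq (u i - a - real r))"
    by (intro sum_mono)
  then have common: "- (real x * (2 * real r * w))
      \<le> (\<Sum>i<x. pos_sq (u i + a)) - 2 * (\<Sum>i<x. pos_sq (u i)) + (\<Sum>i<x. pos_sq (u i - a - real r))"
    by (simp add: sum.distrib sum_subtractf sum_distrib_left)
  have dec: "pos_sq (u i) - pos_sq (u i - \<delta>) \<le> 2 * \<delta> * w" if "0 \<le> \<delta>" for i \<delta>
  proof -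
    have "2 * \<delta> * max 0 (u i) \<le> 2 * \<delta> * w"
      using w that by (intro mult_left_mono) auto
    with pos_sq_decrease[OF that, of "u i"] show ?thesis
      by simp
  qed
  \<comment> \<open>The two matched entries of row \<open>j + 2\<close> lie below \<open>u i\<close>
    by \<open>a + r\<close> and \<open>a + r + 2s\<close>; the slope bound \<open>2w\<close> is
    applied to each.\<close>
  have new: "- (4 * (a + real r + real s) * w)
      \<le> pos_sq (u i - (a + real r)) + pos_sq (u i - (a + real r + 2 * real s)) - 2 * pos_sq (u i)" for i
    using dec[of "a + real r" i] dec[of "a + real r + 2 * real s" i] a by (simp add: algebra_simps)
  have "- (real x * (2 * real r * w)) - 8 * (a + real r + real s) * w
      \<le> model n j - 2 * model n (j + 1) + model n (j + 2)"
    using common new[of x] new[of "x + 1"] unfolding m0 m1 m2 by (simp add: algebra_simps)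
  \<comment> \<open>Two new entries of row \<open>j + 1\<close> give the factor 8; with the 2 from
    the common indices this makes the constant 10.\<close>
  moreover have "8 * (a + real r + real s) * w \<le> 8 * (real r * real x) * w"
  proof -
    have "real j + real k + 2 \<le> real x"
      using k_pos by (simp add: x_def len_def)
    then have "real r * (real j + real k + 2) \<le> real r * real x"
      by (intro mult_left_mono) auto
    moreover have "a + real r + real s = real r * (real j + real k + 2)"
      by (simp add: a_def algebra_simps)
    ultimately show ?thesis
      using w0 by (intro mult_right_mono mult_left_mono) auto
  qed
  ultimately have "- (10 * real r * w * real x)
      \<le> model n j - 2 * model n (j + 1) + model n (j + 2)"
    by (simp add: algebra_simps)
  then show ?thesis
    by (auto simp: w_def x_def)
qed

text \<open>For \<open>i \<le> k\<close> one has \<open>i s \<le> k r / 2 \<le> n / 2\<close>, so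
  \<open>k + 1\<close> of the \<open>2k + 1\<close> entries are at least
  \<open>(n/2)^2\<close>.\<close>

lemma model_0_ge:
  assumes "lag 1 \<le> n"
  shows "(real k + 1) * (real n)\<^sup>2 / 4 \<le> model n 0"
proof -
  have "(\<Sum>i<k + 1. (real n)\<^sup>2 / 4) \<le> (\<Sum>i<k + 1. pos_sq (real n - real (lag 0) - real i * real s))"
  proof (rule sum_mono)
    fix i assume "i \<in> {..<k + 1}"
    then have "real i * real s \<le> real k * real s"
      by (intro mult_right_mono) auto
    moreover have "real k * (2 * real s) \<le> real k * real r"
      using less by (intro mult_left_mono) auto
    moreover have "real r * (2 * real k + 1) / 2 \<le> real n"
      using lag_1_ge assms by linarith
    ultimately have "real n / 2 \<le> real n - real i * real s"
      by (simp add: algebra_simps)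
    then have "(real n / 2)\<^sup>2 \<le> (max 0 (real n - real i * real s))\<^sup>2"
      by (intro power_mono) auto
    then show "(real n)\<^sup>2 / 4 \<le> pos_sq (real n - real (lag 0) - real i * real s)"
      by (simp add: pos_sq_def lag_0 power_divide)
  qed
  also have "\<dots> \<le> model n 0"
    unfolding model_def by (rule sum_mono2) (auto simp: len_def pos_sq_nonneg)
  finally show ?thesis
    by (simp add: algebra_simps)
qed

text \<open>The second differences lose at most \<open>10 r n * (6n/r) = 60 n^2\<close> against the
  gain \<open>(k + 1) n^2 / 4\<close> from row 0; halving the difference gives
  \<open>(k - 239) n^2 / 8\<close>.\<close>

lemma alternating_model_ge:
  assumes "lag 1 \<le> n" "n < 2 * L"
  shows "(real k - 239) * (real n)\<^sup>2 / 8 \<le> (\<Sum>j<2 * L. (- 1) ^ j * model n j)"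
proof -
  define e where "e = (\<lambda>j. if lag j \<le> n then real (len j) else 0)"
  define C where "C = 10 * real r * real n"
  have C: "0 \<le> C"
    by (simp add: C_def)
  have r: "real r > 0"
    using less by simp
  have "model n (2 * L) = 0"
    using assms le_lag[of "2 * L"] by (intro model_eq_0) linarith
  moreover have "- (C * (\<Sum>j<2 * L. e j))
      \<le> (\<Sum>i<L. model n (2 * i) - 2 * model n (2 * i + 1) + model n (2 * i + 2))"
  proof -
    have "(\<Sum>i<L. e (2 * i + 1)) \<le> (\<Sum>j<2 * L. e j)"
      by (rule sum_odd_le) (simp add: e_def)
    then have "- (C * (\<Sum>j<2 * L. e j)) \<le> - (C * (\<Sum>i<L. e (2 * i + 1)))"
      using C by (simp add: mult_left_mono)
    also have "\<dots> = (\<Sum>i<L. - (C * e (2 * i + 1)))"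
      by (simp add: sum_distrib_left sum_negf)
    also have "\<dots> \<le> (\<Sum>i<L. model n (2 * i) - 2 * model n (2 * i + 1) + model n (2 * i + 2))"
    proof (rule sum_mono)
      fix i
      \<comment> \<open>The loss is governed by the length of row \<open>2i\<close> but by the
        activity of row \<open>2i + 1\<close>; enlarging the length makes it a multiple of
        \<open>e (2i + 1)\<close>.\<close>
      have "C * real (len (2 * i)) \<le> C * real (len (2 * i + 1))"
        using C by (intro mult_left_mono) (auto simp: len_def)
      then show "- (C * e (2 * i + 1))
          \<le> model n (2 * i) - 2 * model n (2 * i + 1) + model n (2 * i + 2)"
        using model_second_difference[of "2 * i" n] by (auto simp: e_def C_def split: if_splits)
    qed
    finally show ?thesis .
  qed
  moreover have "C * (\<Sum>j<2 * L. e j) \<le> 60 * (real n)\<^sup>2"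
  proof -
    have "C * (\<Sum>j<2 * L. e j) \<le> C * (6 * real n / real r)"
      using C sum_len_le[OF assms(1)] unfolding e_def by (intro mult_left_mono)
    then show ?thesis
      using r by (simp add: C_def power2_eq_square)
  qed
  moreover have "(real k + 1) * (real n)\<^sup>2 / 4 \<le> model n 0"
    using assms by (intro model_0_ge)
  ultimately show ?thesis
    using alternating_sum_second_differences[of "model n" L] by (simp add: field_simps)
qed

text \<open>For \<open>h\<close> with generating function \<open>H\<close>, this is the coefficient
  of \<open>q^n\<close> in
  \<open>q^(lag j) (1 + q^s + ... + q^(s (len j - 1))) H(q)\<close>.\<close>

definition smoothed :: "(nat \<Rightarrow> real) \<Rightarrow> nat \<Rightarrow> nat \<Rightarrow> real" where
  "smoothed h n j = (\<Sum>i<len j. if lag j + i * s \<le> n then h (n - (lag j + i * s)) else 0)"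

lemma smoothed_eq_0: "n < lag j \<Longrightarrow> smoothed h n j = 0"
  by (simp add: smoothed_def)

text \<open>The error is estimated entry by entry. Entries beyond \<open>n\<close> agree exactly,
  since \<open>pos_sq\<close> vanishes there.\<close>

lemma smoothed_approx:
  assumes "\<And>m. \<bar>h m - \<kappa> * (real m)\<^sup>2\<bar> \<le> 1 + 2 * real m / real r"
  shows "\<bar>smoothed h n j - \<kappa> * model n j\<bar>
           \<le> (1 + 2 * real n / real r) * (if lag j \<le> n then real (len j) else 0)"
proof (cases "lag j \<le> n")
  case True
  have "\<bar>(if lag j + i * s \<le> n then h (n - (lag j + i * s)) else 0)
       - \<kappa> * pos_sq (real n - real (lag j) - real i * real s)\<bar> \<le> 1 + 2 * real n / real r" for i
  proof (cases "lag j + i * s \<le> n")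
    case le: True
    define m where "m = n - (lag j + i * s)"
    have m: "real m = real n - real (lag j) - real i * real s"
      using le by (simp add: m_def of_nat_diff)
    have "1 + 2 * real m / real r \<le> 1 + 2 * real n / real r"
      by (intro add_left_mono divide_right_mono) (auto simp: m_def)
    with assms[of m] le show ?thesis
      unfolding m[symmetric] m_def[symmetric] by (simp add: pos_sq_def)
  next
    case False
    then have "real n \<le> real (lag j + i * s)"
      by (simp only: of_nat_le_iff)
    then have "pos_sq (real n - real (lag j) - real i * real s) = 0"
      by (intro pos_sq_eq_0) simp
    with False show ?thesis
      by simp
  qed
  then have "(\<Sum>i<len j. \<bar>(if lag j + i * s \<le> n then h (n - (lag j + i * s)) else 0)
       - \<kappa> * pos_sq (real n - real (lag j) - real i * real s)\<bar>) \<le> (\<Sum>i<len j. 1 + 2 * real n / real r)"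
    by (intro sum_mono)
  with True show ?thesis
    unfolding smoothed_def model_def sum_distrib_left sum_subtractf[symmetric]
    by (intro order_trans[OF sum_abs]) (simp add: mult.commute)
qed (simp add: smoothed_eq_0 model_eq_0)

text \<open>If \<open>n < lag 1\<close>, only the nonnegative row 0 is left. Otherwise the total
  approximation error is at most \<open>(3n/r)(6n/r) = 18 n^2/r^2\<close>, and the main term is at
  least \<open>\<kappa> (k - 239) n^2 / 8\<close>.\<close>

lemma alternating_smoothed_nonneg:
  assumes nonneg: "\<And>m. 0 \<le> h m"
    and approx: "\<And>m. \<bar>h m - \<kappa> * (real m)\<^sup>2\<bar> \<le> 1 + 2 * real m / real r"
    and \<kappa>: "1 / (6 * real r ^ 3) \<le> \<kappa>"
    and k: "864 * real r + 239 \<le> real k"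
    and n: "n < 2 * L"
  shows "0 \<le> (\<Sum>j<2 * L. (- 1) ^ j * smoothed h n j)"
proof (cases "lag 1 \<le> n")
  case False
  have "(\<Sum>j<2 * L. (- 1) ^ j * smoothed h n j) = (\<Sum>j\<in>{0}. (- 1) ^ j * smoothed h n j)"
  proof (rule sum.mono_neutral_right)
    show "\<forall>j\<in>{..<2 * L} - {0}. (- 1) ^ j * smoothed h n j = 0"
    proof
      fix j assume "j \<in> {..<2 * L} - {0}"
      then have "n < lag j"
        using False lag_1_le[of j] by auto
      then show "(- 1) ^ j * smoothed h n j = 0"
        by (simp add: smoothed_eq_0)
    qed
  qed (use n in auto)
  then show ?thesis
    using nonneg by (simp add: smoothed_def sum_nonneg)
next
  case True
  define e where "e = (\<lambda>j. if lag j \<le> n then real (len j) else 0)"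
  have r: "real r > 0"
    using less by simp
  have \<kappa>_nonneg: "0 \<le> \<kappa>"
    by (rule order_trans[OF _ \<kappa>]) simp
  have rn: "real r \<le> real n"
  proof -
    have "real r * 2 \<le> real r * (2 * real k + 1)"
      using k_pos by (intro mult_left_mono) auto
    with lag_1_ge True show ?thesis
      by linarith
  qed
  have "\<bar>(\<Sum>j<2 * L. (- 1) ^ j * smoothed h n j) - \<kappa> * (\<Sum>j<2 * L. (- 1) ^ j * model n j)\<bar>
      = \<bar>\<Sum>j<2 * L. (- 1) ^ j * (smoothed h n j - \<kappa> * model n j)\<bar>"
    by (simp add: sum_distrib_left right_diff_distrib sum_subtractf mult_ac)
  also have "\<dots> \<le> (\<Sum>j<2 * L. \<bar>smoothed h n j - \<kappa> * model n j\<bar>)"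
    by (rule order_trans[OF sum_abs]) (simp add: abs_mult)
  also have "\<dots> \<le> (\<Sum>j<2 * L. (1 + 2 * real n / real r) * e j)"
    unfolding e_def using smoothed_approx[OF approx] by (intro sum_mono)
  also have "\<dots> = (1 + 2 * real n / real r) * (\<Sum>j<2 * L. e j)"
    by (simp add: sum_distrib_left)
  also have "\<dots> \<le> (3 * real n / real r) * (6 * real n / real r)"
  proof (rule mult_mono)
    show "1 + 2 * real n / real r \<le> 3 * real n / real r"
      using r rn by (simp add: field_simps)
    show "(\<Sum>j<2 * L. e j) \<le> 6 * real n / real r"
      unfolding e_def using sum_len_le[OF True] .
  qed (auto simp: e_def intro: sum_nonneg)
  \<comment> \<open>The constant 864 is \<open>18 * 6 * 8\<close>, so that the main term exactly
    covers the error at the smallest admissible \<kappa> and \<open>k\<close>.\<close>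
  also have "\<dots> = 1 / (6 * real r ^ 3) * (864 * real r * (real n)\<^sup>2 / 8)"
    using r by (simp add: field_simps power2_eq_square power3_eq_cube)
  also have "\<dots> \<le> \<kappa> * ((real k - 239) * (real n)\<^sup>2 / 8)"
    using k \<kappa> \<kappa>_nonneg by (intro mult_mono divide_right_mono mult_right_mono) auto
  also have "\<dots> \<le> \<kappa> * (\<Sum>j<2 * L. (- 1) ^ j * model n j)"
    using alternating_model_ge[OF True n] \<kappa>_nonneg by (intro mult_left_mono)
  finally show ?thesis
    by linarith
qed

end

section \<open>The quotients\<close>

lemma fps_divide_eq_mult_inverse:
  fixes f g :: "'a :: field fps"
  assumes "fps_nth g 0 \<noteq> 0"
  shows "f / g = f * inverse g"
  using assms by (simp add: fps_divide_unit)

context truncated_theta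
begin

definition three_parts_gf :: "real fps" where
  "three_parts_gf = inverse (1 - fps_X ^ (r - s)) * inverse (1 - fps_X ^ (2 * r - s))
             * inverse (1 - fps_X ^ (r + s))"

text \<open>\<open>1 - q^(s len j)\<close> is \<open>1 - q^s\<close> times a geometric sum of
  \<open>len j\<close> terms, and the factor \<open>1 - q^s\<close> cancels.\<close>

lemma main_term_mult_nth:
  "fps_nth (main_term r s k j * (inverse (1 - fps_X ^ s) * three_parts_gf)) n
     = (- 1) ^ j * smoothed (fps_nth three_parts_gf) n j"
proof -
  have "main_term r s k j
      = (- 1) ^ j * (fps_X ^ lag j * ((1 - fps_X ^ s) * (\<Sum>i<len j. (fps_X ^ s) ^ i)))"
  proof -
    have "2 * j * s + (2 * k + 1) * s = s * len j"
      by (simp add: len_def algebra_simps)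
    then show ?thesis
      unfolding main_term_def lag_def
      by (simp only: power_mult one_diff_power_eq) (simp only: mult.assoc)
  qed
  moreover have "(1 - fps_X ^ s) * inverse (1 - fps_X ^ s) = (1 :: real fps)"
    using s_pos by (intro inverse_mult_eq_1') (simp add: fps_X_power_nth)
  moreover have "main_term r s k j * (inverse (1 - fps_X ^ s) * three_parts_gf)
      = ((1 - fps_X ^ s) * inverse (1 - fps_X ^ s))
        * ((- 1) ^ j * (fps_X ^ lag j * ((\<Sum>i<len j. (fps_X ^ s) ^ i) * three_parts_gf)))"
    unfolding calculation(1) by (simp only: mult_ac)
  ultimately have "main_term r s k j * (inverse (1 - fps_X ^ s) * three_parts_gf)
      = (- 1) ^ j * (fps_X ^ lag j * ((\<Sum>i<len j. (fps_X ^ s) ^ i) * three_parts_gf))"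
    by (simp only: mult_1_left)
  also have "\<dots> = (- 1) ^ j * (\<Sum>i<len j. fps_X ^ (lag j + i * s) * three_parts_gf)"
    by (simp add: sum_distrib_left sum_distrib_right power_add mult_ac flip: power_mult)
  also have "fps_nth \<dots> n = (- 1) ^ j * smoothed (fps_nth three_parts_gf) n j"
    by (cases "even j")
      (auto simp: smoothed_def fps_sum_nth fps_X_power_mult_nth intro!: sum.cong)
  finally show ?thesis .
qed

lemma main_term_nth_eq_0:
  assumes "n < j"
  shows "fps_nth (main_term r s k j) n = 0"
proof -
  have "n < lag j"
    using assms le_lag[of j] by linarith
  then show ?thesis
    unfolding main_term_def lag_def
    by (cases "even j") (simp_all add: mult.assoc fps_X_power_mult_nth)
qed

lemma nonneg_three_parts_gf: "nonneg_fps three_parts_gf"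
  unfolding three_parts_gf_def using less
  by (intro nonneg_fps_mult nonneg_fps_inverse_one_minus) auto

text \<open>\<open>gcd(r - s, 2r - s) = gcd(r - s, r) = gcd(s, r) = 1\<close>, so these two parts
  serve as the coprime pair. Both denominators in the error are at least \<open>r\<close>.\<close>

lemma three_parts_gf_asymptotics:
  assumes "coprime r s"
  shows "\<bar>fps_nth three_parts_gf m - 1 / (2 * real (r - s) * real (r + s) * real (2 * r - s)) * (real m)\<^sup>2\<bar>
           \<le> 1 + 2 * real m / real r"
proof -
  have r: "real r > 0" and "r - s > 0"
    using less by simp_all
  have "coprime (r - s) r"
  proof (rule coprimeI)
    fix d assume "d dvd r - s" "d dvd r"
    then have "d dvd r - (r - s)"
      by (rule dvd_diff_nat[rotated])
    moreover have "r - (r - s) = s"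
      using less by simp
    ultimately have "d dvd s"
      by metis
    with \<open>d dvd r\<close> assms show "is_unit d"
      using coprime_common_divisor by blast
  qed
  moreover have "2 * r - s = (r - s) + r"
    using less by simp
  ultimately have "coprime (r - s) (2 * r - s)"
    by (simp add: coprime_iff_gcd_eq_1)
  then have "\<bar>fps_nth three_parts_gf m - (real m)\<^sup>2 / (2 * real (r - s) * real (r + s) * real (2 * r - s))\<bar>
      \<le> real m / (real (r - s) * real (2 * r - s)) + real m / real (r + s) + 1"
    unfolding three_parts_gf_def using less by (intro three_parts_asymptotics) auto
  also have "\<dots> \<le> real m / real r + real m / real r + 1"
  proof (intro add_mono divide_left_mono order_refl)
    have "1 * r \<le> (r - s) * (2 * r - s)"
      using less by (intro mult_mono) auto
    then show "real r \<le> real (r - s) * real (2 * r - s)"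
      by (simp only: of_nat_mult[symmetric] of_nat_le_iff mult_1)
  qed (use less r in auto)
  finally show ?thesis
    by simp
qed

text \<open>\<open>r - s \<le> r\<close> and
  \<open>(r + s)(2r - s) = 2r^2 + rs - s^2 \<le> 3r^2\<close>.\<close>

lemma leading_coeff_ge:
  "1 / (6 * real r ^ 3) \<le> 1 / (2 * real (r - s) * real (r + s) * real (2 * r - s))"
proof -
  have "(r - s) * (r + s) * (2 * r - s) \<le> r * (3 * r * r)"
  proof -
    have "real s * real r \<le> real r * real r"
      using less by (intro mult_right_mono) auto
    then have "real (r + s) * real (2 * r - s) \<le> real (3 * r * r)"
      using less by (simp add: of_nat_diff algebra_simps add_increasing)
    then have "(r + s) * (2 * r - s) \<le> 3 * r * r"
      by (simp only: of_nat_mult[symmetric] of_nat_le_iff)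
    then have "(r - s) * ((r + s) * (2 * r - s)) \<le> r * (3 * r * r)"
      by (rule mult_le_mono[OF diff_le_self])
    then show ?thesis
      by (simp only: mult.assoc)
  qed
  then have "real ((r - s) * (r + s) * (2 * r - s)) \<le> real (r * (3 * r * r))"
    by (simp only: of_nat_le_iff)
  then have upper: "2 * real (r - s) * real (r + s) * real (2 * r - s) \<le> 6 * real r ^ 3"
    by (simp add: power3_eq_cube mult_ac)
  have "0 < 2 * real (r - s) * real (r + s) * real (2 * r - s)"
    using less by simp
  then show ?thesis
    using upper by (rule frac_le[OF zero_le_one order_refl])
qed

lemma nonneg_main:
  assumes "coprime r s" "864 * real r + 239 \<le> real k"
  shows "nonneg_fps ((\<Sum>j. main_term r s k j) * (inverse (1 - fps_X ^ s) * three_parts_gf))"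
  unfolding nonneg_fps_def
proof
  fix n
  have "fps_nth ((\<Sum>j. main_term r s k j) * (inverse (1 - fps_X ^ s) * three_parts_gf)) n
      = (\<Sum>j<2 * (n + 1). (- 1) ^ j * smoothed (fps_nth three_parts_gf) n j)"
    unfolding main_term_mult_nth[symmetric]
    by (rule fps_nth_suminf_mult) (auto simp: main_term_nth_eq_0)
  also have "\<dots> \<ge> 0"
    using nonneg_three_parts_gf
    by (intro alternating_smoothed_nonneg[OF _ three_parts_gf_asymptotics[OF assms(1)] leading_coeff_ge assms(2)])
      (auto simp: nonneg_fps_def)
  finally show "0 \<le> fps_nth ((\<Sum>j. main_term r s k j) * (inverse (1 - fps_X ^ s) * three_parts_gf)) n" .
qed

section \<open>Reduction of the truncated tail to the first quotient\<close>

lemma tail_term_eq: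
  "tail_term r s (i + k)
     = (- 1) ^ k * fps_X ^ (r * k * (k + 1) div 2 - s * k) * main_term r s k i"
proof -
  define a where "a = r * i * (i + 2 * k + 1) div 2"
  define b where "b = r * k * (k + 1) div 2"
  have a: "r * (i\<^sup>2 + (2 * k + 1) * i) div 2 = a"
    by (simp add: a_def power2_eq_square algebra_simps)
  have two: "r * (i + k) * (i + k + 1) div 2 = a + b"
  proof -
    \<comment> \<open>This splitting separates the exponent of the main term from a power of
      \<open>q\<close> depending on \<open>k\<close> alone.\<close>
    have "r * (i + k) * (i + k + 1) = r * i * (i + 2 * k + 1) + r * k * (k + 1)"
      by (simp add: algebra_simps)
    moreover have "2 dvd r * k * (k + 1)"
      using tail_exponent(1)[OF less] .
    ultimately show ?thesis
      by (simp only: a_def b_def div_plus_div_distrib_dvd_right)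
  qed
  have "s * i \<le> a" "s * k \<le> b"
    using main_exponent(2)[OF less, of i k] tail_exponent(2)[OF less, of k] a
    by (simp_all add: b_def)
  then have exps: "a + b - s * (i + k) = (b - s * k) + (a - s * i)"
    "a + b + (i + k + 1) * s = (b - s * k) + (a - s * i) + (2 * i * s + (2 * k + 1) * s)"
    by (simp_all add: algebra_simps)
  have distrib: "(x * y) * (p * q - p * q * u) = y * p * (x * q * (1 - u))" for x y p q u :: "real fps"
    by (simp add: algebra_simps)
  show ?thesis
    unfolding tail_term_def main_term_def two a b_def[symmetric] exps
      power_add[of "- 1" i k] power_add[of fps_X "b - s * k"]
      power_add[of fps_X "b - s * k + (a - s * i)"] by (rule distrib)
qed

lemma suminf_tail_term:
  "(\<Sum>i. tail_term r s (i + k))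
     = (- 1) ^ k * fps_X ^ (r * k * (k + 1) div 2 - s * k) * (\<Sum>j. main_term r s k j)"
proof (rule fps_ext)
  fix n
  define c :: "real fps" where "c = (- 1) ^ k * fps_X ^ (r * k * (k + 1) div 2 - s * k)"
  have tail: "tail_term r s (i + k) = main_term r s k i * c" for i
    by (simp add: tail_term_eq c_def mult.commute)
  have "fps_nth (main_term r s k j * c) l = 0" if "l < j" for j l
    unfolding fps_mult_nth using that by (intro sum.neutral) (auto simp: main_term_nth_eq_0)
  then have "fps_nth ((\<Sum>i. tail_term r s (i + k)) * 1) n = (\<Sum>j<n + 1. fps_nth (main_term r s k j * c * 1) n)"
    unfolding tail by (intro fps_nth_suminf_mult) auto
  also have "\<dots> = fps_nth ((\<Sum>j. main_term r s k j) * c) n"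
    by (subst fps_nth_suminf_mult[of _ _ "n + 1"]) (auto simp: main_term_nth_eq_0)
  finally show "fps_nth (\<Sum>i. tail_term r s (i + k)) n = fps_nth (c * (\<Sum>j. main_term r s k j)) n"
    by (simp add: mult.commute)
qed

lemma main_quotient_eq:
  "(\<Sum>j. main_term r s k j)
      / ((1 - fps_X ^ s) * (1 - fps_X ^ (r - s)) * (1 - fps_X ^ (r + s)) * (1 - fps_X ^ (2 * r - s)))
    = (\<Sum>j. main_term r s k j) * (inverse (1 - fps_X ^ s) * three_parts_gf)"
  using s_pos less unfolding three_parts_gf_def
  by (subst fps_divide_eq_mult_inverse) (auto simp: fps_X_power_nth fps_inverse_mult mult_ac)

text \<open>Two factors are peeled off each infinite product, which exposes \<open>s\<close>,
  \<open>r + s\<close>, \<open>r - s\<close> and \<open>2r - s\<close> as exponents. The sign in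
  front cancels the sign \<open>(-1)^k\<close> from the index shift.\<close>

lemma tail_quotient_eq:
  "(- 1) ^ k * ((\<Sum>i. tail_term r s (i + k))
      / (qpoch_inf (fps_X ^ s) (fps_X ^ r) * qpoch_inf (fps_X ^ (r - s)) (fps_X ^ r)))
    = fps_X ^ (r * k * (k + 1) div 2 - s * k)
      * ((\<Sum>j. main_term r s k j) * (inverse (1 - fps_X ^ s) * three_parts_gf))
      * (inverse (qpoch_inf (fps_X ^ (s + r + r)) (fps_X ^ r))
         * inverse (qpoch_inf (fps_X ^ (r - s + r + r)) (fps_X ^ r)))"
proof -
  have step: "qpoch_inf (fps_X ^ a) (fps_X ^ r)
      = (1 - fps_X ^ a) * (1 - fps_X ^ (a + r)) * qpoch_inf (fps_X ^ (a + r + r)) (fps_X ^ r)"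
    if "a > 0" for a
    using that less by (simp add: qpoch_inf_step[of a r] qpoch_inf_step[of "a + r" r] mult.assoc)
  have inv: "inverse (qpoch_inf (fps_X ^ s) (fps_X ^ r) * qpoch_inf (fps_X ^ (r - s)) (fps_X ^ r))
    = (inverse (1 - fps_X ^ s) * three_parts_gf)
      * (inverse (qpoch_inf (fps_X ^ (s + r + r)) (fps_X ^ r))
         * inverse (qpoch_inf (fps_X ^ (r - s + r + r)) (fps_X ^ r)))"
  proof -
    have "r - s + r = 2 * r - s" "s + r = r + s"
      using less by simp_all
    moreover have "0 < s" "0 < r - s"
      using s_pos less by simp_all
    ultimately show ?thesis
      unfolding step[OF \<open>0 < s\<close>] step[OF \<open>0 < r - s\<close>] fps_inverse_mult three_parts_gf_def
      by (simp only: mult_ac)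
  qed
  have unit: "fps_nth (qpoch_inf (fps_X ^ s) (fps_X ^ r) * qpoch_inf (fps_X ^ (r - s)) (fps_X ^ r)) 0 \<noteq> 0"
    using s_pos less by (simp add: qpoch_inf_nth_0)
  have cancel: "x * (x * p * M * (W * J)) = p * (M * W) * J" if "x * x = 1" for x p M W J :: "real fps"
  proof -
    have "x * (x * p * M * (W * J)) = (x * x) * (p * (M * W) * J)"
      by (simp only: mult_ac)
    with that show ?thesis
      by simp
  qed
  have "(- 1) ^ k * (- 1) ^ k = (1 :: real fps)"
    by (simp flip: power_mult_distrib)
  then show ?thesis
    unfolding suminf_tail_term fps_divide_eq_mult_inverse[OF unit] inv by (rule cancel)
qed

lemma nonneg_tail:
  assumes "coprime r s" "864 * real r + 239 \<le> real k"
  shows "nonneg_fps ((- 1) ^ k * ((\<Sum>i. tail_term r s (i + k))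
      / (qpoch_inf (fps_X ^ s) (fps_X ^ r) * qpoch_inf (fps_X ^ (r - s)) (fps_X ^ r))))"
  unfolding tail_quotient_eq using s_pos less assms
  by (intro nonneg_fps_mult[OF nonneg_fps_mult] nonneg_fps_mult[OF nonneg_fps_inverse_qpoch_inf]
      nonneg_fps_inverse_qpoch_inf nonneg_fps_X_power nonneg_main) auto

end

section \<open>The threshold on \<open>k\<close> and the conclusion\<close>

lemma linear_bound_of_threshold:
  fixes r s k :: nat
  assumes "0 < s" "2 * s < r"
    and "64 * real r ^ 9 * real s / (real r - 2 * real s) ^ 3 \<le> real k"
  shows "864 * real r + 239 \<le> real k"
proof -
  have r: "3 \<le> real r" and d: "0 < real r - 2 * real s" "real r - 2 * real s \<le> real r"
    using assms(1,2) by auto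
  have "864 * real r + 239 \<le> 1000 * real r"
    using r by simp
  \<comment> \<open>By \<open>s \<ge> 1\<close> and \<open>r - 2s \<le> r\<close> the threshold is
    at least \<open>64 r^6\<close>, and \<open>r \<ge> 3\<close> turns five of these powers into a
    constant far above 1000.\<close>
  also have "\<dots> \<le> 64 * 3 ^ 5 * real r"
    by simp
  also have "\<dots> \<le> 64 * real r ^ 5 * real r"
    using r by (intro mult_right_mono mult_left_mono power_mono) auto
  also have "\<dots> = 64 * real r ^ 9 * 1 / real r ^ 3"
    using r by (simp add: field_simps eval_nat_numeral)
  also have "\<dots> \<le> 64 * real r ^ 9 * real s / (real r - 2 * real s) ^ 3"
    using assms(1) d r by (intro frac_le mult_left_mono power_mono) auto
  finally show ?thesis
    using assms(3) by linarith
qed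

theorem corollary1p6:
  fixes r s k :: nat
  assumes "r > 0" and "s > 0" and "k > 0"
    and "1 \<le> s" and "real s < real r / 2"
    and "Gcd {s, r - s, r + s, 2 * r - s} = 1"
    and "real k \<ge> 64 * real r ^ 9 * real s / (real r - 2 * real s) ^ 3"
  shows "(\<forall>n. 0 \<le> fps_nth
            ((\<Sum>j. main_term r s k j)
              / ((1 - fps_X ^ s) * (1 - fps_X ^ (r - s))
                  * (1 - fps_X ^ (r + s)) * (1 - fps_X ^ (2 * r - s)))) n)
       \<and> (\<forall>n. 0 \<le> fps_nth
            ((- 1) ^ k * ((\<Sum>i. tail_term r s (i + k))
              / (qpoch_inf (fps_X ^ s) (fps_X ^ r)
                  * qpoch_inf (fps_X ^ (r - s)) (fps_X ^ r)))) n)"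
proof -
  have less: "2 * s < r"
    using assms(5) by linarith
  interpret truncated_theta r s k
    using assms(2,3) less by unfold_locales
  \<comment> \<open>A common divisor of \<open>r\<close> and \<open>s\<close> divides all four
    exponents, so the gcd hypothesis yields coprimality of \<open>r\<close> and
    \<open>s\<close>.\<close>
  have "gcd r s dvd Gcd {s, r - s, r + s, 2 * r - s}"
    by (rule Gcd_greatest) (auto intro: dvd_diff_nat dvd_add dvd_mult)
  then have "gcd r s dvd 1"
    unfolding assms(6) .
  then have "coprime r s"
    by (simp add: coprime_iff_gcd_eq_1)
  moreover have "864 * real r + 239 \<le> real k"
    using linear_bound_of_threshold assms(2,7) less by blast
  ultimately show ?thesis
    unfolding main_quotient_eq
    using nonneg_main nonneg_tail unfolding nonneg_fps_def by blast
qed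

end
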